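(* Let $d,d_1,\ldots,d_t$ be positive integers such that $d_1\leq\cdots\leq d_t\leq d$, and set $d_0=0$ and $d_{t+1}=d$. Then, for all non-negative integers $n$, the number of partitions of $n$ into parts congruent to $d_1,\ldots,d_t \bmod d$, where parts congruent to $d_i \bmod d$ with size at least $d_i$ are indexed by $i$, is equal to the number of partitions $(\lambda_1,\lambda_2,\ldots)$ into parts repeating at most $t$ times, and such that $$n=\sum_{i=1}^{t+1}(d_{i}-d_{i-1})\sum_{j\equiv i \bmod (t+1)} \lambda_j.$$ The corresponding $q$-series identity is $$\sum_{\lambda\in \mathcal{P}_{t+1}} q^{\sum_{i=1}^{t+1}(d_{i}-d_{i-1})\sum_{j\equiv i \bmod (t+1)} \lambda_j} = \frac{1}{(q^{d_1},\ldots,q^{d_t};q^d)_\infty}.$$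
   Context: Partitions are written as infinite non-increasing sequences $(\lambda_j)_{j\ge1}$ of non-negative integers with finitely many positive terms; "parts repeating at most $t$ times" means every positive integer occurs at most $t$ times. $\mathcal P_{t+1}$ denotes the set of partitions in which every positive integer occurs at most $t$ times. The inner sums run over $j\ge1$. "Indexed by $i$" means that a part congruent to $d_i$ mod $d$ carries the label $i$; if several of the $d_i$ coincide, a part in that residue class comes in several labelled kinds, one for each such $i$. $(a_1,\dots,a_t;q^d)_\infty=\prod_{i=1}^t\prod_{k\ge0}(1-a_iq^{dk})$. The identity is between formal power series in $q$. *)

theory Defs
  imports
    "HOL-Analysis.Analysis"
    "HOL-Computational_Algebra.Formal_Power_Series"
    "HOL-Number_Theory.Cong"
    "HOL-Library.Multiset"
begin

text \<open>
  A partition \<open>(\<lambda>\<^sub>1, \<lambda>\<^sub>2, \<dots>)\<close> is a function \<open>l\<close> on the naturals with \<open>l j\<close> standing for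
  \<open>\<lambda>\<^sub>j\<^sub>+\<^sub>1\<close>; the index shift makes sequences indexed by positive integers correspond exactly
  to functions of type \<open>nat \<Rightarrow> nat\<close>, so that they can be counted.
\<close>

definition is_partition :: "(nat \<Rightarrow> nat) \<Rightarrow> bool" where
  "is_partition l \<longleftrightarrow> antimono l \<and> finite {j. l j > 0}"

text \<open>\<open>partitions_repeating t\<close> is the set written \<open>\<P>\<^sub>t\<^sub>+\<^sub>1\<close>.\<close>

definition partitions_repeating :: "nat \<Rightarrow> (nat \<Rightarrow> nat) set" where
  "partitions_repeating t = {l. is_partition l \<and> (\<forall>m>0. card {j. l j = m} \<le> t)}"

text \<open>
  The inner sum runs over the finitely many nonzero terms of a partition. The differences are
  only used for nondecreasing \<open>ds\<close>, so that subtraction on \<open>nat\<close> does not truncate.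
\<close>

definition weight :: "nat \<Rightarrow> (nat \<Rightarrow> nat) \<Rightarrow> (nat \<Rightarrow> nat) \<Rightarrow> nat" where
  "weight t ds l =
     (\<Sum>i=1..t+1. (ds i - ds (i - 1)) * (\<Sum>j | l j > 0 \<and> [Suc j = i] (mod (t + 1)). l j))"

text \<open>
  Partitions of \<open>n\<close> with labelled parts: a part is a pair of its size and its label \<open>i\<close>, so
  parts of equal size with different labels are different parts.
\<close>

definition labelled_partitions :: "nat \<Rightarrow> nat \<Rightarrow> (nat \<Rightarrow> nat) \<Rightarrow> nat \<Rightarrow> (nat \<times> nat) multiset set" where
  "labelled_partitions t d ds n =
     {M. (\<forall>(s, i) \<in># M. i \<in> {1..t} \<and> s \<ge> ds i \<and> [s = ds i] (mod d)) \<and>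
         sum_mset (image_mset fst M) = n}"

text \<open>
  \<open>qpochhammer_inf a q\<close> is \<open>(a; q)\<^sub>\<infinity>\<close>; the infinite product converges with respect to the
  library topology on formal power series.
\<close>

definition qpochhammer_inf :: "rat fps \<Rightarrow> rat fps \<Rightarrow> rat fps" where
  "qpochhammer_inf a q = (\<Prod>k. 1 - a * q ^ k)"

end

theory Submission
  imports Defs
begin

text \<open>
  Put \<open>m = t + 1\<close>, \<open>F h = d (h div m) + d\<^sub>r\<close> with \<open>r = h mod m\<close>, \<open>p\<^sub>h = q ^ F h\<close> and \<open>Q = q ^ d\<close>.
  A labelled part is the same as a number \<open>h\<close> not divisible by \<open>m\<close>, of size \<open>F h\<close>, and a
  column of height \<open>h\<close> of a Young diagram contributes \<open>F h\<close> to the weight of a partition. Removing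
  the first column shows that the generating function \<open>U\<^sub>H\<close> of the partitions in
  \<open>\<P>\<^sub>t\<^sub>+\<^sub>1\<close> with at most \<open>H\<close> parts satisfies
  \<open>U\<^sub>H = U\<^sub>H\<^sub>-\<^sub>1 + p\<^sub>H (U\<^sub>H - U\<^sub>H\<^sub>-\<^sub>m)\<close>. The adjoint recursion
  \<open>b\<^sub>H - b\<^sub>H\<^sub>+\<^sub>1 = p\<^sub>H (b\<^sub>H - Q b\<^sub>H\<^sub>+\<^sub>m)\<close> has the explicit solution
  \<open>b\<^sub>H = (\<Sum>k. g\<^sub>k (Q; Q)\<^sub>k / (Q ^ s; Q)\<^sub>k\<^sub>+\<^sub>1)\<close>, where \<open>s = \<lceil>H / m\<rceil>\<close> and \<open>g\<^sub>k\<close> counts the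
  \<open>k\<close>-element multisets of labelled parts \<open>h \<ge> H\<close>. The pairing of the two solutions does not depend
  on \<open>H\<close>: it tends to the generating function of \<open>\<P>\<^sub>t\<^sub>+\<^sub>1\<close> as \<open>H\<close> grows, and at the start it is
  \<open>b\<^sub>1 - Q b\<^sub>m\<close>, which telescopes to the generating function of all multisets of labelled parts.
\<close>

unbundle fps_syntax
unbundle no vec_syntax

subsection \<open>Generating functions of weighted sets\<close>

definition fiber_gf :: "'a set \<Rightarrow> ('a \<Rightarrow> nat) \<Rightarrow> rat fps" where
  "fiber_gf S w = Abs_fps (\<lambda>n. of_nat (card {x \<in> S. w x = n}))"

lemma fiber_gf_nth [simp]: "fiber_gf S w $ n = of_nat (card {x \<in> S. w x = n})"
  by (simp add: fiber_gf_def)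

lemma fiber_gf_Un_disjoint:
  assumes "\<And>n. finite {x \<in> A. w x = n}" "\<And>n. finite {x \<in> B. w x = n}" "A \<inter> B = {}"
  shows "fiber_gf (A \<union> B) w = fiber_gf A w + fiber_gf B w"
proof (rule fps_ext)
  fix n
  have "{x \<in> A \<union> B. w x = n} = {x \<in> A. w x = n} \<union> {x \<in> B. w x = n}" by auto
  moreover have "card \<dots> = card {x \<in> A. w x = n} + card {x \<in> B. w x = n}"
    using assms by (intro card_Un_disjoint) auto
  ultimately show "fiber_gf (A \<union> B) w $ n = (fiber_gf A w + fiber_gf B w) $ n" by simp
qed

text \<open>Serves three times: adding a column to a diagram, adding a part to a multiset, and
  shifting all parts of a multiset by one period.\<close>

lemma fiber_gf_bij_shift:
  assumes "bij_betw f A B" "\<And>x. x \<in> A \<Longrightarrow> v (f x) = c + w x"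
  shows "fiber_gf B v = fps_X ^ c * fiber_gf A w"
proof (rule fps_ext)
  fix n
  have inj: "inj_on f A" and B: "B = f ` A" using assms(1) by (auto simp: bij_betw_def)
  show "fiber_gf B v $ n = (fps_X ^ c * fiber_gf A w) $ n"
  proof (cases "n < c")
    case True
    then have "card {y \<in> B. v y = n} = 0" using assms(2) B by (auto simp: card_eq_0_iff)
    with True show ?thesis by (simp add: fps_X_power_mult_nth)
  next
    case False
    have "{y \<in> B. v y = n} = f ` {x \<in> A. w x = n - c}"
      using assms(2) B False by fastforce
    moreover have "card (f ` {x \<in> A. w x = n - c}) = card {x \<in> A. w x = n - c}"
      by (rule card_image) (rule inj_on_subset[OF inj], auto)
    ultimately show ?thesis using False by (simp add: fps_X_power_mult_nth)
  qed
qed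

lemma has_sum_fiber_gf:
  assumes "\<And>n. finite {x \<in> A. w x = n}"
  shows "((\<lambda>x. fps_X ^ w x) has_sum fiber_gf A w) A"
proof (rule has_sum_fpsI)
  fix n
  have eq: "{x \<in> A. (fps_X ^ w x :: rat fps) $ n \<noteq> 0} = {x \<in> A. w x = n}" by auto
  show "finite {x \<in> A. (fps_X ^ w x :: rat fps) $ n \<noteq> 0}" unfolding eq by (rule assms)
  show "fiber_gf A w $ n = (\<Sum>x | x \<in> A \<and> (fps_X ^ w x :: rat fps) $ n \<noteq> 0. (fps_X ^ w x) $ n)"
    unfolding eq by simp
qed

text \<open>
  Infinite sums of power series are only taken along families for which the \<open>k\<close>-th term has
  order at least \<open>k\<close>, so that the \<open>n\<close>-th coefficient of the sum involves only \<open>k \<le> n\<close>.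
\<close>

definition graded :: "(nat \<Rightarrow> rat fps) \<Rightarrow> bool" where
  "graded f \<longleftrightarrow> (\<forall>k. \<forall>n<k. f k $ n = 0)"

definition graded_sum :: "(nat \<Rightarrow> rat fps) \<Rightarrow> rat fps" where
  "graded_sum f = Abs_fps (\<lambda>n. \<Sum>k\<le>n. f k $ n)"

lemma graded_mult_right:
  assumes "graded f"
  shows "graded (\<lambda>k. f k * g k)"
  unfolding graded_def
proof (intro allI impI)
  fix k n :: nat
  assume "n < k"
  then have "f k $ i = 0" if "i \<le> n" for i using assms that by (auto simp: graded_def)
  then show "(f k * g k) $ n = 0" by (simp add: fps_mult_nth)
qed

lemma graded_sum_nth:
  assumes "graded f" "n \<le> N"
  shows "graded_sum f $ n = (\<Sum>k\<le>N. f k $ n)"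
proof -
  have "(\<Sum>k\<le>n. f k $ n) = (\<Sum>k\<le>N. f k $ n)"
    using assms by (intro sum.mono_neutral_left) (auto simp: graded_def)
  then show ?thesis by (simp add: graded_sum_def)
qed

lemma graded_sum_diff: "graded_sum f - graded_sum g = graded_sum (\<lambda>k. f k - g k)"
  by (rule fps_ext) (simp add: graded_sum_def sum_subtractf)

lemma graded_sum_mult_left:
  assumes "graded f"
  shows "a * graded_sum f = graded_sum (\<lambda>k. a * f k)"
proof (rule fps_ext)
  fix n
  have "(a * graded_sum f) $ n = (\<Sum>i=0..n. a $ i * (\<Sum>k\<le>n. f k $ (n - i)))"
    unfolding fps_mult_nth by (intro sum.cong refl) (simp add: graded_sum_nth[OF assms, of _ n])
  also have "\<dots> = (\<Sum>k\<le>n. \<Sum>i=0..n. a $ i * f k $ (n - i))"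
    unfolding sum_distrib_left by (rule sum.swap)
  finally show "(a * graded_sum f) $ n = graded_sum (\<lambda>k. a * f k) $ n"
    by (simp add: graded_sum_def fps_mult_nth)
qed

lemma graded_sum_Suc:
  assumes "graded f"
  shows "graded_sum f = f 0 + graded_sum (\<lambda>k. f (Suc k))"
proof (rule fps_ext)
  fix n
  have "graded_sum f $ n = (\<Sum>k\<le>Suc n. f k $ n)" by (rule graded_sum_nth) (use assms in auto)
  also have "\<dots> = f 0 $ n + (\<Sum>k\<le>n. f (Suc k) $ n)" by (rule sum.atMost_Suc_shift)
  finally show "graded_sum f $ n = (f 0 + graded_sum (\<lambda>k. f (Suc k))) $ n"
    by (simp add: graded_sum_def)
qed

section \<open>Limits of power series and the infinite q-Pochhammer product\<close>

lemma tendsto_mult_fps: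
  fixes a b :: "'a :: ring_1 fps"
  assumes "(f \<longlongrightarrow> a) F" "(g \<longlongrightarrow> b) F"
  shows "((\<lambda>x. f x * g x) \<longlongrightarrow> a * b) F"
proof (rule tendsto_fpsI)
  fix n
  have "\<forall>\<^sub>F x in F. \<forall>i\<in>{..n}. f x $ i = a $ i \<and> g x $ i = b $ i"
    using assms unfolding tendsto_fps_iff
    by (subst eventually_ball_finite_distrib) (auto intro: eventually_conj)
  then show "\<forall>\<^sub>F x in F. (f x * g x) $ n = (a * b) $ n"
    by eventually_elim (auto simp: fps_mult_nth intro!: sum.cong)
qed

lemma tendsto_prod_fps:
  fixes f :: "'b \<Rightarrow> 'c \<Rightarrow> 'a :: comm_ring_1 fps"
  assumes "\<And>i. i \<in> I \<Longrightarrow> (f i \<longlongrightarrow> L i) F"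
  shows "((\<lambda>x. \<Prod>i\<in>I. f i x) \<longlongrightarrow> (\<Prod>i\<in>I. L i)) F"
  using assms by (induction I rule: infinite_finite_induct) (auto intro: tendsto_mult_fps)

text \<open>A factor \<open>1 - fps_X ^ (a + d * k)\<close> with \<open>k > n\<close> leaves
  coefficient \<open>n\<close> alone, so that coefficient of the partial products is constant from
  \<open>n\<close> on.\<close>

lemma qpochhammer_inf_tendsto:
  assumes "a > 0" "d > 0"
  shows "(\<lambda>n. \<Prod>k<n. 1 - fps_X ^ a * (fps_X ^ d) ^ k)
    \<longlonglongrightarrow> qpochhammer_inf (fps_X ^ a) (fps_X ^ d)"
proof -
  define f where "f k = (1 - fps_X ^ a * (fps_X ^ d) ^ k :: rat fps)" for k
  define L where "L = Abs_fps (\<lambda>n. (\<Prod>k\<le>n. f k) $ n)"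
  have f_alt: "f k = 1 - fps_X ^ (a + d * k)" for k
    by (simp add: f_def power_add power_mult)
  have nth: "(\<Prod>k\<le>n + j. f k) $ n = L $ n" for n j
  proof (induction j)
    case 0
    then show ?case by (simp add: L_def)
  next
    case (Suc j)
    have "n + j < d * Suc (n + j)" using assms by (cases d) auto
    then have "n < a + d * Suc (n + j)" by linarith
    then have "((\<Prod>k\<le>n + j. f k) * f (Suc (n + j))) $ n = (\<Prod>k\<le>n + j. f k) $ n"
      unfolding f_alt[of "Suc (n + j)"] right_diff_distrib
      by (subst (2) mult.commute) (simp add: fps_X_power_mult_nth del: mult_Suc_right)
    with Suc show ?case by simp
  qed
  have lim: "(\<lambda>n. \<Prod>k\<le>n. f k) \<longlonglongrightarrow> L"
  proof (rule tendsto_fpsI)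
    fix n
    show "\<forall>\<^sub>F N in sequentially. (\<Prod>k\<le>N. f k) $ n = L $ n"
      using eventually_ge_at_top[of n] by eventually_elim (metis nth le_add_diff_inverse)
  qed
  \<comment> \<open>\<open>raw_has_prod\<close> demands a nonzero limit, which the constant
    coefficient provides.\<close>
  have "L $ 0 = 1" using assms by (simp add: L_def f_def)
  then have "L \<noteq> 0" by auto
  with lim have "f has_prod L" by (simp add: has_prod_def raw_has_prod_def)
  then have "L = qpochhammer_inf (fps_X ^ a) (fps_X ^ d)"
    unfolding qpochhammer_inf_def f_def by (rule has_prod_unique)
  moreover have "(\<lambda>n. \<Prod>k<n. f k) \<longlonglongrightarrow> L"
    using lim by (subst filterlim_sequentially_Suc[symmetric]) (simp add: lessThan_Suc_atMost)
  ultimately show ?thesis by (simp add: f_def)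
qed

subsection \<open>Columns and weights\<close>

locale residue_weights =
  fixes t d :: nat and ds :: "nat \<Rightarrow> nat"
  assumes d_pos: "d > 0"
    and ds_pos: "\<And>i. 1 \<le> i \<Longrightarrow> i \<le> t \<Longrightarrow> ds i > 0"
    and ds_mono: "\<And>i. i \<le> t \<Longrightarrow> ds i \<le> ds (Suc i)"
    and ds_0: "ds 0 = 0"
    and ds_Suc_t: "ds (Suc t) = d"
begin

text \<open>A column of height \<open>h\<close> of a Young diagram contributes \<open>F h\<close> to the weight.\<close>

definition F :: "nat \<Rightarrow> nat" where
  "F h = d * (h div Suc t) + ds (h mod Suc t)"

lemma F_pos: "h > 0 \<Longrightarrow> F h > 0"
proof (cases "h div Suc t = 0")
  case True
  assume "h > 0"
  with True have "1 \<le> h" "h \<le> t" by (auto simp: div_eq_0_iff)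
  then show ?thesis using ds_pos[of h] by (simp add: F_def)
qed (use d_pos in \<open>auto simp: F_def\<close>)

lemma F_add_period: "F (h + Suc t) = d + F h"
  by (simp add: F_def del: add_Suc_right)

lemma F_period: "F (Suc t * s) = d * s"
  by (simp add: F_def ds_0 del: mult_Suc)

text \<open>The common truncation bound: columns or parts of such a height cannot affect coefficient
  \<open>n\<close>.\<close>

lemma F_large:
  assumes "h \<ge> Suc t * Suc n"
  shows "n < F h"
proof -
  have "Suc n = Suc t * Suc n div Suc t" by (rule nonzero_mult_div_cancel_left[symmetric]) simp
  also have "\<dots> \<le> h div Suc t" by (rule div_le_mono[OF assms])
  also have "\<dots> \<le> F h" using d_pos by (simp add: F_def trans_le_add1)
  finally show ?thesis by simp
qed

text \<open>The coefficient of \<open>l j\<close> in the weight, and also the increment of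
  \<open>F\<close> from \<open>j\<close> to \<open>Suc j\<close>.\<close>

definition slope :: "nat \<Rightarrow> nat" where
  "slope j = ds (Suc (j mod Suc t)) - ds (j mod Suc t)"

lemma F_Suc: "F (Suc h) = F h + slope h"
proof (cases "Suc (h mod Suc t) = Suc t")
  \<comment> \<open>At the end of a period the increment is \<open>d - ds t\<close>; the conventions
    \<open>ds 0 = 0\<close> and \<open>ds (Suc t) = d\<close> make the formula fit.\<close>
  case True
  then have "Suc h mod Suc t = 0" "Suc h div Suc t = Suc (h div Suc t)"
    by (auto simp: mod_Suc div_Suc)
  with True ds_mono[of t] show ?thesis by (simp add: F_def slope_def ds_0 ds_Suc_t)
next
  case False
  then have "Suc h mod Suc t = Suc (h mod Suc t)" "Suc h div Suc t = h div Suc t"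
    by (auto simp: mod_Suc div_Suc)
  with ds_mono[of "h mod Suc t"] show ?thesis
    by (simp add: F_def slope_def less_Suc_eq_le[symmetric])
qed

lemma sum_slope: "(\<Sum>j<h. slope j) = F h"
  by (induction h) (simp_all add: F_Suc, simp add: F_def ds_0)

lemma slope_0: "slope 0 > 0"
  using F_Suc[of 0] F_pos[of 1] by (simp add: F_def ds_0)

text \<open>Each index lies in exactly one residue class, so the double sum can be swapped once the
  support is replaced by a common bound \<open>N\<close>.\<close>

lemma weight_eq_sum_slope:
  assumes "\<And>j. j \<ge> N \<Longrightarrow> l j = 0"
  shows "weight t ds l = (\<Sum>j<N. slope j * l j)"
proof -
  have inner: "(\<Sum>j | l j > 0 \<and> [Suc j = Suc k] (mod (t + 1)). l j)
      = (\<Sum>j<N. if j mod Suc t = k then l j else 0)" if "k < Suc t" for k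
  proof -
    have cong: "[Suc j = Suc k] (mod (t + 1)) \<longleftrightarrow> j mod Suc t = k" for j
      using cong_add_rcancel_nat[of j 1 k "Suc t"] that by (simp add: cong_def)
    have "(\<Sum>j | l j > 0 \<and> [Suc j = Suc k] (mod (t + 1)). l j)
        = (\<Sum>j | j \<in> {..<N} \<and> j mod Suc t = k. l j)"
      unfolding cong
    proof (rule sum.mono_neutral_left)
      show "{j. l j > 0 \<and> j mod Suc t = k} \<subseteq> {j. j \<in> {..<N} \<and> j mod Suc t = k}"
      proof
        fix j assume "j \<in> {j. l j > 0 \<and> j mod Suc t = k}"
        then show "j \<in> {j. j \<in> {..<N} \<and> j mod Suc t = k}"
          using assms[of j] by (cases "j < N") auto
      qed
    qed auto
    also have "\<dots> = (\<Sum>j<N. if j mod Suc t = k then l j else 0)"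
      by (rule sum.inter_filter) simp
    finally show ?thesis .
  qed
  have "weight t ds l = (\<Sum>k<Suc t. (ds (Suc k) - ds k) * (\<Sum>j<N. if j mod Suc t = k then l j else 0))"
    unfolding weight_def One_nat_def add_Suc_right add_0_right sum.atLeast_Suc_atMost_Suc_shift
    by (rule sum.cong) (use inner in auto)
  also have "\<dots> = (\<Sum>k<Suc t. \<Sum>j<N. if j mod Suc t = k then (ds (Suc k) - ds k) * l j else 0)"
    unfolding sum_distrib_left by (intro sum.cong refl) auto
  also have "\<dots> = (\<Sum>j<N. \<Sum>k<Suc t. if j mod Suc t = k then (ds (Suc k) - ds k) * l j else 0)"
    by (rule sum.swap)
  also have "\<dots> = (\<Sum>j<N. slope j * l j)"
    by (intro sum.cong refl) (simp add: slope_def del: sum.lessThan_Suc)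
  finally show ?thesis .
qed

section \<open>Partitions with bounded multiplicities and their finiteness for a given
  weight\<close>

abbreviation P :: "(nat \<Rightarrow> nat) set" where
  "P \<equiv> partitions_repeating t"

lemma P_antimono: "l \<in> P \<Longrightarrow> i \<le> j \<Longrightarrow> l j \<le> l i"
  by (auto simp: partitions_repeating_def is_partition_def antimono_def)

lemma P_zero: "l \<in> P \<Longrightarrow> l N = 0 \<Longrightarrow> N \<le> j \<Longrightarrow> l j = 0"
  using P_antimono[of l N j] by simp

lemma P_card: "l \<in> P \<Longrightarrow> m > 0 \<Longrightarrow> card {j. l j = m} \<le> t"
  by (auto simp: partitions_repeating_def)

lemma P_ex_zero:
  assumes "l \<in> P"
  obtains N where "N \<ge> H" "l N = 0"
proof -
  have "finite {j. l j > 0}" using assms by (simp add: partitions_repeating_def is_partition_def)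
  then have "finite ({j. l j > 0} \<union> {..<H})" by simp
  then obtain N where "N \<notin> {j. l j > 0} \<union> {..<H}" using ex_new_if_finite infinite_UNIV_nat by blast
  with that[of N] show ?thesis by simp
qed

lemma P_I:
  assumes "\<And>i j. i \<le> j \<Longrightarrow> l j \<le> l i" "l N = 0" "\<And>m. m > 0 \<Longrightarrow> card {j. l j = m} \<le> t"
  shows "l \<in> P"
proof -
  have "{j. l j > 0} \<subseteq> {..<N}"
  proof
    fix j assume "j \<in> {j. l j > 0}"
    then show "j \<in> {..<N}" using assms(1)[of N j] assms(2) by (cases "N \<le> j") auto
  qed
  then have "finite {j. l j > 0}" using finite_subset by blast
  with assms show ?thesis by (simp add: partitions_repeating_def is_partition_def antimono_def)
qed

text \<open>If \<open>l H\<close> is nonzero, the terms with index below \<open>H\<close> are all at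
  least 1, and they already contribute at least the sum of their slopes, which is
  \<open>F H\<close>.\<close>

lemma P_weight_zero:
  assumes "l \<in> P" "F H > weight t ds l"
  shows "l H = 0"
proof (rule ccontr)
  assume nz: "l H \<noteq> 0"
  obtain N where N: "N \<ge> H" "l N = 0" using P_ex_zero[OF assms(1)] .
  have "F H \<le> (\<Sum>j<H. slope j * l j)"
    unfolding sum_slope[symmetric]
  proof (rule sum_mono)
    fix j assume "j \<in> {..<H}"
    then show "slope j \<le> slope j * l j" using P_antimono[OF assms(1), of j H] nz by simp
  qed
  also have "\<dots> \<le> (\<Sum>j<N. slope j * l j)" using N by (intro sum_mono2) auto
  also have "\<dots> = weight t ds l"
    by (rule weight_eq_sum_slope[symmetric]) (use P_zero[OF assms(1) N(2)] in auto)
  finally show False using assms(2) by simp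
qed

text \<open>The largest term \<open>l 0\<close> enters the weight with the positive coefficient
  \<open>slope 0\<close>.\<close>

lemma P_le_weight:
  assumes "l \<in> P"
  shows "l j \<le> weight t ds l"
proof -
  obtain N where N: "N \<ge> 1" "l N = 0" using P_ex_zero[OF assms] .
  have "l j \<le> slope 0 * l 0"
    using P_antimono[OF assms, of 0 j] slope_0 by (cases "slope 0") (auto intro: trans_le_add1)
  also have "\<dots> \<le> (\<Sum>j<N. slope j * l j)"
    using N by (intro member_le_sum[of 0 _ "\<lambda>j. slope j * l j"]) auto
  also have "\<dots> = weight t ds l"
    by (rule weight_eq_sum_slope[symmetric]) (use P_zero[OF assms N(2)] in auto)
  finally show ?thesis .
qed

lemma finite_P_weight: "finite {l \<in> P. weight t ds l = n}"
proof (rule finite_subset)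
  let ?H = "Suc t * Suc n"
  show "{l \<in> P. weight t ds l = n}
      \<subseteq> {l. \<forall>j. (j \<in> {..<?H} \<longrightarrow> l j \<in> {..n}) \<and> (j \<notin> {..<?H} \<longrightarrow> l j = 0)}"
  proof
    fix l assume "l \<in> {l \<in> P. weight t ds l = n}"
    then have l: "l \<in> P" "weight t ds l = n" by auto
    have "l j = 0" if "j \<ge> ?H" for j
      using P_weight_zero[OF l(1)] F_large[OF that] l(2) by simp
    with P_le_weight[OF l(1)] l(2)
    show "l \<in> {l. \<forall>j. (j \<in> {..<?H} \<longrightarrow> l j \<in> {..n}) \<and> (j \<notin> {..<?H} \<longrightarrow> l j = 0)}"
      by (auto simp del: mult_Suc)
  qed
  show "finite {l. \<forall>j. (j \<in> {..<?H} \<longrightarrow> l j \<in> {..n}) \<and> (j \<notin> {..<?H} \<longrightarrow> l j = (0::nat))}"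
    by (rule finite_set_of_finite_funs) auto
qed

text \<open>Indices start at 0, so \<open>l H = 0\<close> says that there are at most
  \<open>H\<close> parts.\<close>

definition U :: "nat \<Rightarrow> rat fps" where
  "U H = fiber_gf {l \<in> P. l H = 0} (weight t ds)"

text \<open>The case distinction gives the value 0 at negative indices, where truncated subtraction
  would give \<open>U 0 = 1\<close>.\<close>

definition U_below :: "nat \<Rightarrow> rat fps" where
  "U_below H = (if H \<le> t then 0 else U (H - Suc t))"

text \<open>The map adds a column of height \<open>H\<close> to the Young diagram.\<close>

lemma add_column_bij:
  assumes "H > 0"
  shows "bij_betw (\<lambda>l j. l j + (if j < H then 1 else 0))
    {l \<in> P. l H = 0 \<and> \<not> (t < H \<and> l (H - Suc t) = 0)} {l \<in> P. l H = 0 \<and> l (H - 1) \<noteq> 0}"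
    (is "bij_betw ?f ?A ?B")
proof (rule bij_betw_byWitness[where f' = "\<lambda>l j. l j - 1"])
  have below: "l j > 0" if "l \<in> P" "l (H - 1) \<noteq> 0" "j < H" for l j
  proof -
    have "j \<le> H - 1" using that(3) by simp
    then show ?thesis using P_antimono[OF that(1), of j "H - 1"] that(2) by simp
  qed
  show "\<forall>l\<in>?A. (\<lambda>j. ?f l j - 1) = l"
  proof (intro ballI ext)
    fix l j assume l: "l \<in> ?A"
    then show "?f l j - 1 = l j" using P_zero[of l H j] by (cases "j < H") auto
  qed
  show "\<forall>l\<in>?B. ?f (\<lambda>j. l j - 1) = l"
  proof (intro ballI ext)
    fix l j assume l: "l \<in> ?B"
    show "?f (\<lambda>j. l j - 1) j = l j"
      using below[of l j] P_zero[of l H j] l by (cases "j < H") auto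
  qed
  show "?f ` ?A \<subseteq> ?B"
  proof (rule image_subsetI)
    fix l assume "l \<in> ?A"
    then have l: "l \<in> P" "l H = 0" and cond: "\<not> (t < H \<and> l (H - Suc t) = 0)" by auto
    have zero: "l j = 0" if "H \<le> j" for j using P_zero[OF l that] .
    have "?f l \<in> P"
    proof (rule P_I)
      show "?f l j \<le> ?f l i" if "i \<le> j" for i j
        using P_antimono[OF l(1) that] that by auto
      show "?f l H = 0" using l by simp
      fix m :: nat assume "m > 0"
      show "card {j. ?f l j = m} \<le> t"
      proof (cases "m = 1")
        case False
        have "{j. ?f l j = m} = {j. l j = m - 1}" 
          using zero False \<open>m > 0\<close> by (auto simp: not_less split: if_splits)
        then show ?thesis using P_card[OF l(1), of "m - 1"] False \<open>m > 0\<close> by simp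
      next
        case True
        \<comment> \<open>The new parts 1 arise from zero terms below \<open>H\<close>. If
          \<open>t < H\<close>, then \<open>cond\<close> makes the term at \<open>H - Suc t\<close>
          positive, so only the last \<open>t\<close> positions remain.\<close>
        have "{j. ?f l j = m} \<subseteq> {H - t..<H}"
        proof
          fix j assume "j \<in> {j. ?f l j = m}"
          then have j: "j < H" "l j = 0" using True zero[of j] by (auto split: if_splits)
          have "H - t \<le> j"
          proof (rule ccontr)
            assume "\<not> H - t \<le> j"
            then have "t < H" "j \<le> H - Suc t" by auto
            with cond P_antimono[OF l(1), of j "H - Suc t"] j show False by simp
          qed
          with j show "j \<in> {H - t..<H}" by simp
        qed
        then have "card {j. ?f l j = m} \<le> card {H - t..<H}" by (intro card_mono) auto
        then show ?thesis by simp
      qed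
    qed
    with assms l show "?f l \<in> ?B" by simp
  qed
  show "(\<lambda>l j. l j - 1) ` ?B \<subseteq> ?A"
  proof (rule image_subsetI)
    fix l assume "l \<in> ?B"
    then have l: "l \<in> P" "l H = 0" and nz: "l (H - 1) \<noteq> 0" by auto
    have "(\<lambda>j. l j - 1) \<in> P"
    proof (rule P_I)
      show "l j - 1 \<le> l i - 1" if "i \<le> j" for i j
        using P_antimono[OF l(1) that] by simp
      show "l H - 1 = 0" using l by simp
      fix m :: nat assume "m > 0"
      then have "{j. l j - 1 = m} = {j. l j = Suc m}" by auto
      then show "card {j. l j - 1 = m} \<le> t" using P_card[OF l(1), of "Suc m"] by simp
    qed
    moreover have "\<not> (t < H \<and> l (H - Suc t) - 1 = 0)"
    proof
      assume that: "t < H \<and> l (H - Suc t) - 1 = 0"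
      \<comment> \<open>Otherwise the part 1 would occur at least \<open>t + 1\<close> times in
        \<open>l\<close>.\<close>
      have "{H - Suc t..<H} \<subseteq> {j. l j = 1}"
      proof
        fix j assume "j \<in> {H - Suc t..<H}"
        then show "j \<in> {j. l j = 1}"
          using P_antimono[OF l(1), of "H - Suc t" j] below[OF l(1) nz, of j] that by simp
      qed
      moreover have "{j. l j = 1} \<subseteq> {..<H}" 
      proof
        fix j assume "j \<in> {j. l j = 1}"
        then show "j \<in> {..<H}" using P_zero[OF l, of j] by (cases "j < H") auto
      qed
      ultimately have "card {H - Suc t..<H} \<le> card {j. l j = 1}"
        by (intro card_mono) (auto intro: finite_subset)
      then show False using P_card[OF l(1), of 1] that by simp
    qed
    ultimately show "(\<lambda>j. l j - 1) \<in> ?A"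
      using l by (simp add: not_le)
  qed
qed

text \<open>The partitions with at most \<open>Suc H\<close> parts are split twice: into
  \<open>D\<close> and \<open>B\<close> by whether there are exactly \<open>Suc H\<close> parts, and
  into \<open>C\<close> and \<open>A\<close> by whether a further column of height
  \<open>Suc H\<close> would violate the multiplicity bound. Adding that column maps
  \<open>A\<close> onto \<open>B\<close>.\<close>

lemma U_Suc:
  "U (Suc H) = U H + fps_X ^ F (Suc H) * (U (Suc H) - U_below (Suc H))"
proof -
  let ?w = "weight t ds"
  define A where "A = {l \<in> P. l (Suc H) = 0 \<and> \<not> (t < Suc H \<and> l (Suc H - Suc t) = 0)}"
  define B where "B = {l \<in> P. l (Suc H) = 0 \<and> l H \<noteq> 0}"
  define C where "C = {l \<in> P. t < Suc H \<and> l (Suc H - Suc t) = 0}"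
  have fin: "finite {l \<in> S. ?w l = n}" if "S \<subseteq> P" for S n
    by (rule finite_subset[OF _ finite_P_weight[of n]]) (use that in auto)
  define D where "D = {l \<in> P. l H = 0}"
  have sub: "A \<subseteq> P" "B \<subseteq> P" "C \<subseteq> P" "D \<subseteq> P"
    by (auto simp: A_def B_def C_def D_def)
  have "{l \<in> P. l (Suc H) = 0} = D \<union> B"
    using P_zero[of _ H "Suc H"] by (auto simp: B_def D_def)
  moreover have "fiber_gf (D \<union> B) ?w = fiber_gf D ?w + fiber_gf B ?w"
    by (rule fiber_gf_Un_disjoint[OF fin[OF sub(4)] fin[OF sub(2)]]) (auto simp: B_def D_def)
  ultimately have 1: "U (Suc H) = U H + fiber_gf B ?w"
    by (simp only: U_def D_def)
  have "{l \<in> P. l (Suc H) = 0} = C \<union> A"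
    using P_zero[of _ "Suc H - Suc t" "Suc H"] by (auto simp: A_def C_def)
  moreover have "fiber_gf (C \<union> A) ?w = fiber_gf C ?w + fiber_gf A ?w"
    by (rule fiber_gf_Un_disjoint[OF fin[OF sub(3)] fin[OF sub(1)]]) (auto simp: A_def C_def)
  ultimately have "U (Suc H) = fiber_gf C ?w + fiber_gf A ?w"
    by (simp only: U_def)
  moreover have "fiber_gf C ?w = U_below (Suc H)"
    by (auto simp: C_def U_below_def U_def intro!: fps_ext)
  ultimately have 2: "fiber_gf A ?w = U (Suc H) - U_below (Suc H)" by simp
  have bij: "bij_betw (\<lambda>l j. l j + (if j < Suc H then 1 else 0)) A B"
    using add_column_bij[of "Suc H"] by (simp add: A_def B_def)
  have "fiber_gf B ?w = fps_X ^ F (Suc H) * fiber_gf A ?w"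
  proof (rule fiber_gf_bij_shift[OF bij])
    fix l assume "l \<in> A"
    then have zero: "l j = 0" if "Suc H \<le> j" for j using P_zero that by (auto simp: A_def)
    have "?w (\<lambda>j. l j + (if j < Suc H then 1 else 0)) = (\<Sum>j<Suc H. slope j * (l j + (if j < Suc H then 1 else 0)))"
      by (rule weight_eq_sum_slope) (simp add: zero)
    also have "\<dots> = (\<Sum>j<Suc H. slope j + slope j * l j)"
      by (intro sum.cong refl) (simp add: distrib_left)
    also have "\<dots> = F (Suc H) + (\<Sum>j<Suc H. slope j * l j)"
      by (simp only: sum.distrib sum_slope)
    also have "(\<Sum>j<Suc H. slope j * l j) = ?w l"
      by (rule weight_eq_sum_slope[symmetric]) (simp add: zero)
    finally show "?w (\<lambda>j. l j + (if j < Suc H then 1 else 0)) = F (Suc H) + ?w l" .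
  qed
  with 1 2 show ?thesis by simp
qed

lemma U_0: "U 0 = 1"
proof -
  have zero: "(\<lambda>_. 0) \<in> P" by (rule P_I[of _ 0]) auto
  moreover have "l = (\<lambda>_. 0)" if "l \<in> P" "l 0 = 0" for l
    using P_zero[OF that] by (simp add: fun_eq_iff)
  ultimately have "{l \<in> P. l 0 = 0} = {\<lambda>_. 0}" by blast
  moreover have "weight t ds (\<lambda>_. 0) = 0" using weight_eq_sum_slope[of 0 "\<lambda>_. 0"] by simp
  ultimately show ?thesis by (auto simp: U_def fps_eq_iff Collect_conv_if)
qed

lemma U_nth_stable:
  assumes "F H > n"
  shows "U H $ n = fiber_gf P (weight t ds) $ n"
proof -
  have "{l \<in> {l \<in> P. l H = 0}. weight t ds l = n} = {l \<in> P. weight t ds l = n}"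
    using P_weight_zero assms by auto
  then show ?thesis by (simp only: U_def fiber_gf_nth)
qed

end

subsection \<open>Multisets of labelled parts\<close>

text \<open>
  The closed form is
  \<open>ladder Q k s = (1 - Q) \<cdots> (1 - Q ^ k) / ((1 - Q ^ s) \<cdots> (1 - Q ^ (s + k)))\<close>; the recursion
  avoids the quotient.
\<close>

primrec ladder :: "rat fps \<Rightarrow> nat \<Rightarrow> nat \<Rightarrow> rat fps" where
  "ladder Q 0 s = inverse (1 - Q ^ s)"
| "ladder Q (Suc k) s = ladder Q k s - Q ^ Suc k * ladder Q k (Suc s)"

lemma ladder_0_mult:
  assumes "Q $ 0 = 0" "s > 0"
  shows "ladder Q 0 s * (1 - Q ^ s) = 1"
  using assms by (auto intro!: inverse_mult_eq_1 simp: fps_power_zeroth zero_power)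

text \<open>In the closed form both sides are \<open>(1 - Q) ... (1 - Q ^ k)\<close> divided by
  \<open>(1 - Q ^ (s + 1)) ... (1 - Q ^ (s + k))\<close>. The induction uses the hypothesis at
  \<open>s\<close> and at \<open>Suc s\<close>.\<close>

lemma ladder_step:
  assumes "Q $ 0 = 0" "s > 0"
  shows "ladder Q k s * (1 - Q ^ s) = ladder Q k (Suc s) * (1 - Q ^ (s + Suc k))"
  using assms(2)
proof (induction k arbitrary: s)
  case 0
  then show ?case using ladder_0_mult[OF assms(1), of s] ladder_0_mult[OF assms(1), of "Suc s"] by simp
next
  case (Suc k)
  let ?a = "ladder Q k s" and ?b = "ladder Q k (Suc s)" and ?c = "ladder Q k (Suc (Suc s))"
  have 1: "?a * (1 - Q ^ s) = ?b * (1 - Q ^ (s + Suc k))" using Suc by simp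
  have 2: "?b * (1 - Q ^ Suc s) = ?c * (1 - Q ^ (Suc s + Suc k))" using Suc.IH[of "Suc s"] by simp
  have "ladder Q (Suc k) s * (1 - Q ^ s) = ?a * (1 - Q ^ s) - Q ^ Suc k * ?b * (1 - Q ^ s)"
    by (simp add: algebra_simps)
  also have "\<dots> = ?b * (1 - Q ^ Suc k)"
    unfolding 1 by (simp add: algebra_simps power_add)
  \<comment> \<open>Splits \<open>1 - Q ^ Suc k\<close> as
    \<open>(1 - Q ^ (s + k + 2)) - Q ^ Suc k * (1 - Q ^ Suc s)\<close>, so that the recursion of
    \<open>ladder\<close> reappears.\<close>
  also have "\<dots> = ?b * (1 - Q ^ (s + Suc (Suc k))) - Q ^ Suc k * (?b * (1 - Q ^ Suc s))"
    by (simp add: algebra_simps power_add)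
  also have "\<dots> = ladder Q (Suc k) (Suc s) * (1 - Q ^ (s + Suc (Suc k)))"
    unfolding 2 by (simp add: algebra_simps)
  finally show ?case .
qed

text \<open>At \<open>s = 1\<close> all factors of the closed form but one cancel; this evaluates
  the pairing at its start.\<close>

lemma ladder_1:
  assumes "Q $ 0 = 0"
  shows "ladder Q k 1 * (1 - Q ^ Suc k) = 1"
proof (induction k)
  case 0
  then show ?case using ladder_0_mult[OF assms, of 1] by simp
next
  case (Suc k)
  let ?a = "ladder Q k 1" and ?b = "ladder Q k 2"
  have 1: "?a * (1 - Q) = ?b * (1 - Q ^ Suc (Suc k))"
    using ladder_step[OF assms, of 1 k] by (simp add: numeral_2_eq_2)
  \<comment> \<open>The extra factor \<open>1 - Q\<close> makes relation 1 applicable; it is nonzero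
    and is cancelled at the end.\<close>
  have "ladder Q (Suc k) 1 * (1 - Q ^ Suc (Suc k)) * (1 - Q)
      = ?a * (1 - Q) * (1 - Q ^ Suc (Suc k)) - Q ^ Suc k * (1 - Q) * (?b * (1 - Q ^ Suc (Suc k)))"
    by (simp add: algebra_simps numeral_2_eq_2)
  also have "\<dots> = (?a * (1 - Q ^ Suc k)) * (1 - Q)"
    unfolding 1[symmetric] by (simp add: algebra_simps)
  finally have "ladder Q (Suc k) 1 * (1 - Q ^ Suc (Suc k)) * (1 - Q) = 1 * (1 - Q)"
    unfolding Suc .
  moreover have "1 - Q \<noteq> 0" using assms by (auto simp: fps_eq_iff intro: exI[of _ 0])
  ultimately show ?case by (simp only: mult_cancel_right) simp
qed

context residue_weights
begin

definition regular :: "nat \<Rightarrow> nat set" where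
  "regular H = {h. H \<le> h \<and> \<not> Suc t dvd h}"

definition msum :: "nat multiset \<Rightarrow> nat" where
  "msum M = sum_mset (image_mset F M)"

lemma msum_simps [simp]: "msum {#} = 0" "msum (add_mset h M) = F h + msum M"
  by (simp_all add: msum_def)

lemma F_le_msum: "h \<in># M \<Longrightarrow> F h \<le> msum M"
  by (induction M) auto

lemma regular_pos: "h \<in> regular H \<Longrightarrow> h > 0"
  by (cases h) (auto simp: regular_def)

lemma size_le_msum: "set_mset M \<subseteq> regular H \<Longrightarrow> size M \<le> msum M"
proof (induction M)
  case (add h M)
  then have "F h > 0" by (intro F_pos) (auto dest: regular_pos)
  with add show ?case by simp
qed simp

lemma finite_regular_msum: "finite {M. set_mset M \<subseteq> regular H \<and> msum M = n}"
proof (rule finite_subset)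
  show "{M. set_mset M \<subseteq> regular H \<and> msum M = n}
      \<subseteq> (\<Union>k\<le>n. multisets_of_size {..<Suc t * Suc n} k)"
  proof
    fix M assume "M \<in> {M. set_mset M \<subseteq> regular H \<and> msum M = n}"
    then have M: "set_mset M \<subseteq> regular H" "msum M = n" by auto
    have "h < Suc t * Suc n" if "h \<in># M" for h
      using F_large[of n h] F_le_msum[OF that] M(2) by linarith
    with size_le_msum[OF M(1)] M(2)
    show "M \<in> (\<Union>k\<le>n. multisets_of_size {..<Suc t * Suc n} k)"
      by (auto simp: multisets_of_size_def simp del: mult_Suc)
  qed
qed auto

lemma finite_multisets_msum: "finite {M \<in> multisets_of_size (regular H) k. msum M = n}"
  by (rule finite_subset[OF _ finite_regular_msum[of H n]]) (auto simp: multisets_of_size_def)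

definition regular_gf :: "nat \<Rightarrow> nat \<Rightarrow> rat fps" where
  "regular_gf k H = fiber_gf (multisets_of_size (regular H) k) msum"

lemma regular_gf_0 [simp]: "regular_gf 0 H = 1"
proof -
  have "multisets_of_size (regular H) 0 = {{#}}" by (auto simp: multisets_of_size_def)
  then show ?thesis by (auto simp: regular_gf_def fps_eq_iff Collect_conv_if)
qed

text \<open>Every part has positive size, so \<open>k\<close> parts sum to at least
  \<open>k\<close>.\<close>

lemma graded_regular_gf: "graded (\<lambda>k. regular_gf k H)"
  unfolding graded_def
proof (intro allI impI)
  fix k n :: nat assume "n < k"
  then have "msum M \<noteq> n" if "M \<in> multisets_of_size (regular H) k" for M
    using size_le_msum[of M H] that by (auto simp: multisets_of_size_def)
  then have "{M \<in> multisets_of_size (regular H) k. msum M = n} = {}" by auto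
  then show "regular_gf k H $ n = 0" by (simp only: regular_gf_def fiber_gf_nth) simp
qed

lemma regular_gf_dvd: "Suc t dvd H \<Longrightarrow> regular_gf k H = regular_gf k (Suc H)"
proof -
  assume dvd: "Suc t dvd H"
  have "regular H = regular (Suc H)" using dvd by (auto simp: regular_def Suc_le_eq order_le_less)
  then show ?thesis by (simp add: regular_gf_def)
qed

text \<open>Split by whether \<open>H\<close> occurs. If so, one copy is removed; further copies may
  remain, hence \<open>regular_gf k H\<close> in the last term.\<close>

lemma regular_gf_Suc:
  assumes "\<not> Suc t dvd H"
  shows "regular_gf (Suc k) H = regular_gf (Suc k) (Suc H) + fps_X ^ F H * regular_gf k H"
proof -
  let ?B = "add_mset H ` multisets_of_size (regular H) k"
  have reg: "regular H = insert H (regular (Suc H))" using assms by (auto simp: regular_def)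
  have "multisets_of_size (regular H) (Suc k) = multisets_of_size (regular (Suc H)) (Suc k) \<union> ?B"
  proof (intro equalityI subsetI)
    fix M assume M: "M \<in> multisets_of_size (regular H) (Suc k)"
    show "M \<in> multisets_of_size (regular (Suc H)) (Suc k) \<union> ?B"
    proof (cases "H \<in># M")
      case True
      then obtain N where N: "M = add_mset H N" by (metis insert_DiffM)
      with M show ?thesis by (auto simp: multisets_of_size_def)
    qed (use M reg in \<open>auto simp: multisets_of_size_def\<close>)
  qed (use reg in \<open>auto simp: multisets_of_size_def\<close>)
  moreover have "fiber_gf (multisets_of_size (regular (Suc H)) (Suc k) \<union> ?B) msum
      = fiber_gf (multisets_of_size (regular (Suc H)) (Suc k)) msum + fiber_gf ?B msum"
  proof (rule fiber_gf_Un_disjoint)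
    show "finite {M \<in> ?B. msum M = n}" for n
      by (rule finite_subset[OF _ finite_multisets_msum[of H "Suc k" n]])
        (use reg in \<open>auto simp: multisets_of_size_def\<close>)
    show "multisets_of_size (regular (Suc H)) (Suc k) \<inter> ?B = {}"
      by (auto simp: multisets_of_size_def regular_def)
  qed (rule finite_multisets_msum)
  moreover have "fiber_gf ?B msum = fps_X ^ F H * fiber_gf (multisets_of_size (regular H) k) msum"
    by (rule fiber_gf_bij_shift[of "add_mset H"]) (auto simp: bij_betw_def inj_on_def)
  ultimately show ?thesis by (simp add: regular_gf_def)
qed

text \<open>Raising a height by one period preserves non-divisibility and adds \<open>d\<close> to
  the size, for each of the \<open>k\<close> parts.\<close>

lemma regular_gf_shift: "regular_gf k (H + Suc t) = (fps_X ^ d) ^ k * regular_gf k H"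
proof -
  let ?f = "image_mset (\<lambda>h. h + Suc t)"
  have "bij_betw ?f (multisets_of_size (regular H) k) (multisets_of_size (regular (H + Suc t)) k)"
  proof (rule bij_betw_byWitness[where f' = "image_mset (\<lambda>h. h - Suc t)"])
    show "\<forall>M\<in>multisets_of_size (regular H) k. image_mset (\<lambda>h. h - Suc t) (?f M) = M"
      by (simp add: multiset.map_comp comp_def)
    show "\<forall>M\<in>multisets_of_size (regular (H + Suc t)) k. ?f (image_mset (\<lambda>h. h - Suc t) M) = M"
    proof
      fix M assume "M \<in> multisets_of_size (regular (H + Suc t)) k"
      then have "h - Suc t + Suc t = h" if "h \<in># M" for h
        using that by (auto simp: multisets_of_size_def regular_def)
      then show "?f (image_mset (\<lambda>h. h - Suc t) M) = M"
        unfolding multiset.map_comp comp_def by (simp cong: image_mset_cong)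
    qed
    show "?f ` multisets_of_size (regular H) k \<subseteq> multisets_of_size (regular (H + Suc t)) k"
      by (force simp: multisets_of_size_def regular_def subset_iff simp del: add_Suc_right)
    show "image_mset (\<lambda>h. h - Suc t) ` multisets_of_size (regular (H + Suc t)) k
        \<subseteq> multisets_of_size (regular H) k"
    proof clarify
      fix M assume M: "M \<in> multisets_of_size (regular (H + Suc t)) k"
      have "h - Suc t \<in> regular H" if "h \<in># M" for h
      proof -
        have "H + Suc t \<le> h" "\<not> Suc t dvd h"
          using M that by (auto simp: multisets_of_size_def regular_def)
        then show ?thesis by (auto simp: regular_def dvd_minus_self simp del: add_Suc_right)
      qed
      with M show "image_mset (\<lambda>h. h - Suc t) M \<in> multisets_of_size (regular H) k"
        by (auto simp: multisets_of_size_def)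
    qed
  qed
  then have "regular_gf k (H + Suc t) = fps_X ^ (d * k) * regular_gf k H"
    unfolding regular_gf_def
  proof (rule fiber_gf_bij_shift)
    have "msum (?f M) = d * size M + msum M" for M
      by (induction M) (simp_all add: F_add_period del: add_Suc_right)
    then show "msum (?f M) = d * k + msum M" if "M \<in> multisets_of_size (regular H) k" for M
      using that by (simp add: multisets_of_size_def)
  qed
  then show ?thesis by (simp add: power_mult)
qed

lemma regular_gf_nth_0:
  assumes "k > 0" "H \<ge> Suc t * Suc n"
  shows "regular_gf k H $ n = 0"
proof -
  have "msum M \<noteq> n" if M: "M \<in> multisets_of_size (regular H) k" for M
  proof -
    obtain h where h: "h \<in># M" using M assms(1) by (cases M) (auto simp: multisets_of_size_def)
    with M assms have "n < F h" by (intro F_large) (auto simp: multisets_of_size_def regular_def)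
    with F_le_msum[OF h] show ?thesis by simp
  qed
  then have "{M \<in> multisets_of_size (regular H) k. msum M = n} = {}" by auto
  then show ?thesis by (simp only: regular_gf_def fiber_gf_nth) simp
qed

end

subsection \<open>The adjoint recursion\<close>

context residue_weights
begin

text \<open>This is \<open>b\<close> of the adjoint recursion; \<open>(H + t) div Suc t\<close> is
  the ceiling of \<open>H / (t + 1)\<close>.\<close>

definition bridge :: "nat \<Rightarrow> rat fps" where
  "bridge H = graded_sum (\<lambda>k. regular_gf k H * ladder (fps_X ^ d) k ((H + t) div Suc t))"

text \<open>From \<open>H\<close> to \<open>Suc H\<close> only one ingredient changes. If
  \<open>Suc t\<close> divides \<open>H\<close>, the ceiling \<open>s\<close> grows by one, the
  factor \<open>fps_X ^ F H\<close> is \<open>Q ^ s\<close>, and \<open>ladder_step\<close> applies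
  termwise. Otherwise \<open>s\<close> stays, and \<open>regular_gf_Suc\<close> meets the recursion
  defining \<open>ladder\<close>.\<close>

lemma bridge_diff:
  assumes "H > 0"
  shows "bridge H - bridge (Suc H)
    = fps_X ^ F H * (bridge H - fps_X ^ d * bridge (H + Suc t))"
proof -
  define Q :: "rat fps" where "Q = fps_X ^ d"
  define s where "s = (H + t) div Suc t"
  let ?p = "fps_X ^ F H" and ?g = "\<lambda>k. regular_gf k H" and ?g' = "\<lambda>k. regular_gf k (Suc H)"
  have Q0: "Q $ 0 = 0" using d_pos by (simp add: Q_def)
  have s_pos: "s > 0" using assms by (simp add: s_def div_greater_zero_iff)
  note graded = graded_mult_right[OF graded_regular_gf]
  have b: "bridge H = graded_sum (\<lambda>k. ?g k * ladder Q k s)"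
    by (simp add: bridge_def Q_def s_def)
  have "(H + Suc t + t) div Suc t = Suc s"
    unfolding s_def by (metis add.assoc add.commute div_add_self2 Suc_eq_plus1 nat.distinct(1))
  then have "bridge (H + Suc t) = graded_sum (\<lambda>k. ?g k * (Q ^ k * ladder Q k (Suc s)))"
    unfolding bridge_def regular_gf_shift Q_def[symmetric] by (simp add: mult_ac)
  then have "bridge H - Q * bridge (H + Suc t)
      = graded_sum (\<lambda>k. ?g k * (ladder Q k s - Q ^ Suc k * ladder Q k (Suc s)))"
    unfolding b
    by (simp only: graded_sum_mult_left[OF graded] graded_sum_diff) (simp add: algebra_simps)
  then have rhs: "?p * (bridge H - Q * bridge (H + Suc t))
      = graded_sum (\<lambda>k. ?p * (?g k * (ladder Q k s - Q ^ Suc k * ladder Q k (Suc s))))"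
    by (simp only: graded_sum_mult_left[OF graded])
  have "bridge H - bridge (Suc H) = \<dots>"
  proof (cases "Suc t dvd H")
    case True
    then obtain r where r: "H = Suc t * r" by blast
    have "Suc H + t = Suc t * Suc r" by (simp add: r)
    then have "(Suc H + t) div Suc t = Suc r"
      by (simp only: nonzero_mult_div_cancel_left[OF nat.distinct(2)])
    moreover have "s = r" unfolding s_def r by (simp add: div_add1_eq[of "Suc t * r" t] del: mult_Suc)
    ultimately have sr: "s = r" "(Suc H + t) div Suc t = Suc r" by simp_all
    have p: "?p = Q ^ s" unfolding r F_period by (simp add: Q_def power_mult sr(1))
    have "bridge (Suc H) = graded_sum (\<lambda>k. ?g k * ladder Q k (Suc s))"
      unfolding bridge_def regular_gf_dvd[OF True, symmetric] using sr by (simp add: Q_def)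
    then have "bridge H - bridge (Suc H) = graded_sum (\<lambda>k. ?g k * (ladder Q k s - ladder Q k (Suc s)))"
      unfolding b by (simp add: graded_sum_diff right_diff_distrib)
    moreover have "ladder Q k s - ladder Q k (Suc s)
        = Q ^ s * (ladder Q k s - Q ^ Suc k * ladder Q k (Suc s))" for k
      using ladder_step[OF Q0 s_pos, of k] by (simp add: algebra_simps power_add)
    ultimately show ?thesis by (simp only: p mult_ac)
  next
    case False
    have "(Suc H + t) div Suc t = s"
    proof -
      define q r where "q = H div Suc t" and "r = H mod Suc t"
      have H: "H = Suc t * q + r" unfolding q_def r_def by (rule mult_div_mod_eq[symmetric])
      have r: "r > 0" "r < Suc t" using False by (auto simp: r_def dvd_eq_mod_eq_0)
      \<comment> \<open>As \<open>0 < r < Suc t\<close>, both \<open>r\<close> and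
        \<open>r - 1\<close> are valid remainders, so \<open>Suc H\<close> and \<open>H\<close> have
        the same ceiling \<open>Suc q\<close>.\<close>
      have "(Suc H + t) div Suc t = (r + Suc t * Suc q) div Suc t"
        by (rule arg_cong[where f = "\<lambda>a. a div Suc t"]) (simp add: H)
      also have "\<dots> = Suc q" using r by (simp only: div_mult_self2) simp
      also have "\<dots> = (r - 1 + Suc t * Suc q) div Suc t"
        using r by (simp only: div_mult_self2) simp
      also have "\<dots> = s" unfolding s_def
        using r by (intro arg_cong[where f = "\<lambda>a. a div Suc t"]) (simp add: H)
      finally show ?thesis .
    qed
    then have b': "bridge (Suc H) = graded_sum (\<lambda>k. ?g' k * ladder Q k s)"
      by (simp add: bridge_def Q_def)
    \<comment> \<open>The terms for \<open>k = 0\<close> agree and cancel, so the index moves up by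
      one.\<close>
    have "bridge H - bridge (Suc H)
        = graded_sum (\<lambda>k. ?g (Suc k) * ladder Q (Suc k) s - ?g' (Suc k) * ladder Q (Suc k) s)"
      unfolding b b' graded_sum_Suc[OF graded]
      by (simp add: graded_sum_diff del: ladder.simps(2))
    also have "\<dots> = graded_sum (\<lambda>k. ?p * (?g k * ladder Q (Suc k) s))"
      unfolding regular_gf_Suc[OF False] by (simp add: algebra_simps del: ladder.simps(2))
    finally show ?thesis by simp
  qed
  with rhs show ?thesis by (simp add: Q_def)
qed

text \<open>The bilinear concomitant of the recursion and its adjoint. The recursion reaches back
  \<open>t + 1\<close> steps, so the boundary sum has \<open>t + 1\<close> terms.\<close>

definition pairing :: "nat \<Rightarrow> rat fps" where
  "pairing H = bridge (Suc H) * U H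
    - (\<Sum>j = Suc H..<Suc H + Suc t. fps_X ^ F j * bridge j * U_below j)"

text \<open>The boundary sum loses the term at \<open>Suc H\<close> and gains the one a period
  later, whose factor is \<open>fps_X ^ d * fps_X ^ F (Suc H)\<close>. The two recursions make the
  changes cancel.\<close>

lemma pairing_Suc: "pairing (Suc H) = pairing H"
proof -
  define f where "f j = fps_X ^ F j * bridge j * U_below j" for j
  define S where "S = (\<Sum>j = Suc (Suc H)..<Suc H + Suc t. f j)"
  define x :: "rat fps" where "x = fps_X ^ F (Suc H)"
  define u where "u = U (Suc H)"
  define B where "B = bridge (Suc H)"
  have 1: "(\<Sum>j = Suc H..<Suc H + Suc t. f j) = f (Suc H) + S"
    unfolding S_def by (rule sum.atLeast_Suc_lessThan) simp
  have "Suc (Suc H) + Suc t = Suc (Suc H + Suc t)" by simp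
  then have 2: "(\<Sum>j = Suc (Suc H)..<Suc (Suc H) + Suc t. f j) = S + f (Suc H + Suc t)"
    unfolding S_def by (simp only:) (rule sum.atLeastLessThan_Suc, simp)
  have last: "f (Suc H + Suc t) = x * (fps_X ^ d * bridge (Suc H + Suc t)) * u"
    unfolding f_def F_add_period x_def u_def by (simp add: U_below_def power_add mult_ac)
  have U: "U H = u - x * (u - U_below (Suc H))"
    using U_Suc[of H] by (simp add: x_def u_def algebra_simps)
  have diff: "bridge (Suc (Suc H)) = B - x * (B - fps_X ^ d * bridge (Suc H + Suc t))"
    using bridge_diff[of "Suc H"] by (simp add: B_def x_def algebra_simps)
  have "bridge (Suc (Suc H)) * u - (S + f (Suc H + Suc t)) = B * U H - (f (Suc H) + S)"
    unfolding last U diff by (simp add: f_def x_def[symmetric] B_def[symmetric] algebra_simps)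
  then show ?thesis
    unfolding pairing_def f_def[symmetric] 1 2 by (simp add: u_def B_def)
qed

text \<open>Only the boundary term at \<open>Suc t\<close> survives, where \<open>U_below\<close> is
  \<open>U 0 = 1\<close>. Both remaining bridges have ceiling 1, and their difference collapses by
  \<open>ladder_1\<close>.\<close>

lemma pairing_0: "pairing 0 = graded_sum (\<lambda>k. regular_gf k 1)"
proof -
  define Q :: "rat fps" where "Q = fps_X ^ d"
  have Q0: "Q $ 0 = 0" using d_pos by (simp add: Q_def)
  let ?g = "\<lambda>k. regular_gf k 1"
  note graded = graded_mult_right[OF graded_regular_gf]
  have "(\<Sum>j = Suc 0..<Suc 0 + Suc t. fps_X ^ F j * bridge j * U_below j)
      = (\<Sum>j \<in> {Suc t}. fps_X ^ F j * bridge j * U_below j)"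
    by (rule sum.mono_neutral_right) (auto simp: U_below_def)
  also have "\<dots> = Q * bridge (Suc t)"
    using F_period[of 1] by (simp add: U_below_def U_0 Q_def)
  finally have 1: "pairing 0 = bridge 1 - Q * bridge (Suc t)"
    by (simp add: pairing_def U_0)
  have "regular_gf k (Suc t) = Q ^ k * ?g k" for k
    using regular_gf_dvd[of "Suc t" k] regular_gf_shift[of k 1] by (simp add: Q_def)
  moreover have "(Suc t + t) div Suc t = 1" by (simp add: div_nat_eqI)
  ultimately have 2: "bridge (Suc t) = graded_sum (\<lambda>k. ?g k * (Q ^ k * ladder Q k 1))"
    by (simp add: bridge_def Q_def[symmetric] mult_ac)
  have "bridge 1 = graded_sum (\<lambda>k. ?g k * ladder Q k 1)"
    by (simp add: bridge_def Q_def)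
  then have "pairing 0 = graded_sum (\<lambda>k. ?g k * (ladder Q k 1 * (1 - Q ^ Suc k)))"
    unfolding 1 2
    by (simp only: graded_sum_mult_left[OF graded] graded_sum_diff) (simp add: algebra_simps)
  then show ?thesis unfolding ladder_1[OF Q0] by simp
qed

text \<open>For \<open>k > 0\<close> all parts are too large to contribute, and the term for
  \<open>k = 0\<close> is \<open>1 / (1 - Q ^ s)\<close> with \<open>s > n\<close>.\<close>

lemma bridge_nth_large:
  assumes "H \<ge> Suc t * Suc n" "i \<le> n"
  shows "bridge H $ i = 1 $ i"
proof -
  define Q :: "rat fps" where "Q = fps_X ^ d"
  define s where "s = (H + t) div Suc t"
  let ?f = "\<lambda>k. regular_gf k H * ladder Q k s"
  have Q0: "Q $ 0 = 0" using d_pos by (simp add: Q_def)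
  have "Suc n = Suc t * Suc n div Suc t" by (rule nonzero_mult_div_cancel_left[symmetric]) simp
  also have "\<dots> \<le> s" unfolding s_def by (rule div_le_mono) (use assms in simp)
  finally have s: "Suc n \<le> s" .
  then have "i < d * s" using d_pos assms(2) by (cases d) auto
  have "?f k $ i = 0" if "k > 0" for k
  proof -
    have "regular_gf k H $ j = 0" if "j \<le> i" for j
    proof (rule regular_gf_nth_0[OF \<open>k > 0\<close>])
      have "Suc t * Suc j \<le> Suc t * Suc n" using assms(2) that by (intro mult_le_mono) auto
      with assms(1) show "Suc t * Suc j \<le> H" by linarith
    qed
    then show ?thesis by (simp add: fps_mult_nth)
  qed
  then have "(\<Sum>k\<le>i. ?f k $ i) = (\<Sum>k\<in>{0}. ?f k $ i)"
    by (intro sum.mono_neutral_right) auto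
  then have "bridge H $ i = ladder Q 0 s $ i"
    by (simp add: bridge_def graded_sum_def Q_def s_def)
  also have "ladder Q 0 s = 1 + fps_X ^ (d * s) * ladder Q 0 s"
    using ladder_0_mult[OF Q0, of s] s by (simp add: Q_def power_mult algebra_simps)
  also have "\<dots> $ i = 1 $ i"
    unfolding fps_add_nth fps_X_power_mult_nth using \<open>i < d * s\<close> by simp
  finally show ?thesis .
qed

text \<open>Coefficient \<open>n\<close> of the constant pairing is read off at an \<open>H\<close>
  so large that the boundary sum vanishes, the bridge looks like 1, and \<open>U H\<close> has
  stabilised.\<close>

lemma fiber_gf_P: "fiber_gf P (weight t ds) = graded_sum (\<lambda>k. regular_gf k 1)"
proof (rule fps_ext)
  fix n
  define H where "H = Suc t * Suc n"
  have "(fps_X ^ F j * bridge j * U_below j) $ n = 0" if "j \<ge> H" for j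
    using F_large[of n j] that by (simp add: H_def mult.assoc fps_X_power_mult_nth)
  then have pairing: "pairing H $ n = (bridge (Suc H) * U H) $ n"
    unfolding pairing_def by (simp add: fps_sum_nth)
  have "pairing K = pairing 0" for K by (induction K) (simp_all add: pairing_Suc)
  then have "graded_sum (\<lambda>k. regular_gf k 1) $ n = pairing H $ n"
    by (simp add: pairing_0)
  also have "\<dots> = (1 * U H) $ n"
    unfolding pairing fps_mult_nth using bridge_nth_large[of n "Suc H"]
    by (intro sum.cong refl) (simp add: H_def)
  also have "\<dots> = fiber_gf P (weight t ds) $ n"
    using U_nth_stable[of n H] F_large[of n H] by (simp add: H_def)
  finally show "fiber_gf P (weight t ds) $ n = graded_sum (\<lambda>k. regular_gf k 1) $ n" ..
qed

end

subsection \<open>The infinite product\<close>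

context residue_weights
begin

definition all_gf :: "nat \<Rightarrow> rat fps" where
  "all_gf H = graded_sum (\<lambda>k. regular_gf k H)"

lemma all_gf_dvd: "Suc t dvd H \<Longrightarrow> all_gf H = all_gf (Suc H)"
  unfolding all_gf_def using regular_gf_dvd by simp

text \<open>Multiplying by \<open>1 - fps_X ^ F H\<close> removes the geometric series that counts
  the copies of \<open>H\<close>.\<close>

lemma all_gf_not_dvd:
  assumes "\<not> Suc t dvd H"
  shows "all_gf H * (1 - fps_X ^ F H) = all_gf (Suc H)"
proof -
  have "all_gf H - all_gf (Suc H)
      = graded_sum (\<lambda>k. regular_gf (Suc k) H - regular_gf (Suc k) (Suc H))"
    unfolding all_gf_def graded_sum_Suc[OF graded_regular_gf] by (simp add: graded_sum_diff)
  also have "\<dots> = fps_X ^ F H * all_gf H"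
    unfolding regular_gf_Suc[OF assms] all_gf_def by (simp add: graded_sum_mult_left graded_regular_gf)
  finally show ?thesis by (simp add: algebra_simps)
qed

text \<open>The heights between two multiples of \<open>Suc t\<close> supply the factor with index
  \<open>K\<close> of each of the \<open>t\<close> infinite products.\<close>

lemma all_gf_block:
  assumes "j \<le> t"
  shows "all_gf (Suc (Suc t * K)) * (\<Prod>i=1..j. 1 - fps_X ^ ds i * (fps_X ^ d) ^ K)
    = all_gf (Suc (Suc t * K + j))"
  using assms
proof (induction j)
  case (Suc j)
  let ?h = "Suc t * K + Suc j"
  have h: "?h mod Suc t = Suc j" "?h div Suc t = K"
    using Suc.prems by (simp_all del: mult_Suc add_Suc_right)
  then have dvd: "\<not> Suc t dvd ?h" by (simp only: dvd_eq_mod_eq_0)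
  have "F ?h = ds (Suc j) + d * K" by (simp only: F_def h)
  then have F: "fps_X ^ F ?h = fps_X ^ ds (Suc j) * ((fps_X ^ d) ^ K :: rat fps)"
    by (simp only: power_add power_mult)
  have step: "all_gf ?h * (1 - fps_X ^ ds (Suc j) * (fps_X ^ d) ^ K) = all_gf (Suc ?h)"
    using all_gf_not_dvd[OF dvd] unfolding F .
  have "(\<Prod>i=1..Suc j. 1 - fps_X ^ ds i * (fps_X ^ d) ^ K)
      = (\<Prod>i=1..j. 1 - fps_X ^ ds i * (fps_X ^ d) ^ K) * (1 - fps_X ^ ds (Suc j) * (fps_X ^ d) ^ K :: rat fps)"
    by simp
  moreover have "Suc (Suc t * K + j) = ?h" by simp
  ultimately show ?case using Suc step by (simp only: mult.assoc[symmetric] Suc_leD)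
qed simp

lemma all_gf_prod:
  "all_gf 1 * (\<Prod>i=1..t. \<Prod>k<K. 1 - fps_X ^ ds i * (fps_X ^ d) ^ k) = all_gf (Suc (Suc t * K))"
proof (induction K)
  case (Suc K)
  have "all_gf 1 * (\<Prod>i=1..t. \<Prod>k<Suc K. 1 - fps_X ^ ds i * (fps_X ^ d) ^ k)
      = all_gf (Suc (Suc t * K)) * (\<Prod>i=1..t. 1 - fps_X ^ ds i * (fps_X ^ d) ^ K)"
    unfolding Suc[symmetric] by (simp add: prod.distrib mult.assoc)
  also have "\<dots> = all_gf (Suc t * Suc K)"
    unfolding all_gf_block[OF order_refl] by (simp add: algebra_simps)
  also have "\<dots> = all_gf (Suc (Suc t * Suc K))" by (rule all_gf_dvd[OF dvd_triv_left])
  finally show ?case .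
qed simp

lemma all_gf_tendsto: "(\<lambda>K. all_gf (Suc (Suc t * K))) \<longlonglongrightarrow> 1"
proof (rule tendsto_fpsI)
  fix n
  show "\<forall>\<^sub>F K in sequentially. all_gf (Suc (Suc t * K)) $ n = 1 $ n"
    using eventually_ge_at_top[of "Suc n"]
  proof eventually_elim
    case (elim K)
    let ?H = "Suc (Suc t * K)"
    have "Suc t * Suc n \<le> ?H" using mult_le_mono2[OF elim, of "Suc t"] by linarith
    then have "(\<Sum>k\<le>n. regular_gf k ?H $ n) = (\<Sum>k\<in>{0}. regular_gf k ?H $ n)"
      using regular_gf_nth_0 by (intro sum.mono_neutral_right) auto
    then show ?case by (simp add: all_gf_def graded_sum_def)
  qed
qed

lemma all_gf_1: "1 / (\<Prod>i=1..t. qpochhammer_inf (fps_X ^ ds i) (fps_X ^ d)) = all_gf 1"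
proof -
  let ?D = "\<Prod>i=1..t. qpochhammer_inf (fps_X ^ ds i) (fps_X ^ d)"
  have "(\<lambda>K. all_gf 1 * (\<Prod>i=1..t. \<Prod>k<K. 1 - fps_X ^ ds i * (fps_X ^ d) ^ k)) \<longlonglongrightarrow> all_gf 1 * ?D"
    by (intro tendsto_mult_fps tendsto_const tendsto_prod_fps qpochhammer_inf_tendsto d_pos ds_pos) auto
  then have "(\<lambda>K. all_gf (Suc (Suc t * K))) \<longlonglongrightarrow> all_gf 1 * ?D"
    unfolding all_gf_prod .
  \<comment> \<open>Once every part has been removed, only the empty multiset is left; this is the
    limit 1.\<close>
  then have prod: "all_gf 1 * ?D = 1" using all_gf_tendsto LIMSEQ_unique by blast
  then have "?D \<noteq> 0" by (metis mult_zero_right zero_neq_one)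
  then have "all_gf 1 * ?D div ?D = all_gf 1" by (rule nonzero_mult_div_cancel_right)
  then show ?thesis unfolding prod .
qed

section \<open>From multisets of heights to labelled partitions\<close>

lemma all_gf_nth: "all_gf H $ n = of_nat (card {M. set_mset M \<subseteq> regular H \<and> msum M = n})"
proof -
  \<comment> \<open>A multiset of sum \<open>n\<close> has at most \<open>n\<close> elements, so the
    truncation in \<open>graded_sum\<close> loses nothing.\<close>
  have "{M. set_mset M \<subseteq> regular H \<and> msum M = n}
      = (\<Union>k\<le>n. {M \<in> multisets_of_size (regular H) k. msum M = n})"
    using size_le_msum by (auto simp: multisets_of_size_def)
  moreover have "card \<dots> = (\<Sum>k\<le>n. card {M \<in> multisets_of_size (regular H) k. msum M = n})"
    by (rule card_UN_disjoint) (simp_all add: finite_multisets_msum, auto simp: multisets_of_size_def)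
  ultimately show ?thesis
    by (simp add: all_gf_def graded_sum_def regular_gf_def)
qed

text \<open>Division with remainder by \<open>Suc t\<close> turns a height into a label (the
  remainder) and a multiple of \<open>d\<close> to add to \<open>ds i\<close> (the quotient).
  Keeping the label makes the map injective even if some \<open>ds i\<close> coincide.\<close>

lemma labelled_partitions_bij:
  "bij_betw (image_mset (\<lambda>h. (F h, h mod Suc t)))
    {M. set_mset M \<subseteq> regular 1 \<and> msum M = n} (labelled_partitions t d ds n)"
  (is "bij_betw (image_mset ?g) ?A ?B")
proof -
  let ?g' = "\<lambda>(s, i). Suc t * ((s - ds i) div d) + i"
  have g: "?g' (?g h) = h" "h mod Suc t \<in> {1..t}" "F h \<ge> ds (h mod Suc t)"
    "[F h = ds (h mod Suc t)] (mod d)" if "h \<in> regular 1" for h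
  proof -
    show "?g' (?g h) = h" using d_pos by (simp add: F_def del: mult_Suc)
    have "h mod Suc t \<noteq> 0" using that by (auto simp: regular_def dvd_eq_mod_eq_0)
    moreover have "h mod Suc t < Suc t" by simp
    ultimately show "h mod Suc t \<in> {1..t}" by (simp del: mod_less_divisor)
  qed (simp_all add: F_def cong_def)
  have g': "?g (?g' p) = p" "?g' p \<in> regular 1"
    if "p = (s, i)" "i \<in> {1..t}" "s \<ge> ds i" "[s = ds i] (mod d)" for p s i
  proof -
    have "d dvd s - ds i" using that by (simp add: cong_altdef_nat cong_sym_eq)
    then have "d * ((s - ds i) div d) = s - ds i" by simp
    moreover have "?g' p mod Suc t = i" "?g' p div Suc t = (s - ds i) div d"
      using that by (simp_all del: mult_Suc)
    ultimately show "?g (?g' p) = p" "?g' p \<in> regular 1"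
      using that by (auto simp: F_def regular_def dvd_eq_mod_eq_0 simp del: mult_Suc)
  qed
  have id: "image_mset f M = M" if "\<And>x. x \<in># M \<Longrightarrow> f x = x" for f and M :: "'b multiset"
    using that by (induction M) auto
  have msum: "sum_mset (image_mset fst (image_mset ?g M)) = msum M" for M
    by (induction M) auto
  show ?thesis
  proof (rule bij_betw_byWitness[where f' = "image_mset ?g'"])
    show "\<forall>M\<in>?A. image_mset ?g' (image_mset ?g M) = M"
      unfolding multiset.map_comp comp_def using g(1) by (auto intro!: id)
    show "\<forall>M\<in>?B. image_mset ?g (image_mset ?g' M) = M"
    proof
      fix M assume M: "M \<in> ?B"
      show "image_mset ?g (image_mset ?g' M) = M"
        unfolding multiset.map_comp comp_def
      proof (rule id)
        fix p assume "p \<in># M"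
        with M show "?g (?g' p) = p"
          by (cases p) (rule g'(1), auto simp: labelled_partitions_def)
      qed
    qed
    show "image_mset ?g ` ?A \<subseteq> ?B"
    proof (rule image_subsetI)
      fix M assume "M \<in> ?A"
      then show "image_mset ?g M \<in> ?B"
        unfolding labelled_partitions_def mem_Collect_eq msum using g(2-4) by auto
    qed
    show "image_mset ?g' ` ?B \<subseteq> ?A"
    proof (rule image_subsetI)
      fix M assume M: "M \<in> ?B"
      have valid: "?g (?g' p) = p \<and> ?g' p \<in> regular 1" if "p \<in># M" for p
        using M that by (cases p) (intro conjI g'; auto simp: labelled_partitions_def)
      have "image_mset ?g (image_mset ?g' M) = M"
        unfolding multiset.map_comp comp_def by (rule id) (use valid in blast)
      then have "msum (image_mset ?g' M) = sum_mset (image_mset fst M)"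
        using msum[of "image_mset ?g' M"] by simp
      with M valid show "image_mset ?g' M \<in> ?A"
        by (auto simp: labelled_partitions_def)
    qed
  qed
qed

end

theorem corollary1p19:
  fixes t d :: nat and ds :: "nat \<Rightarrow> nat"
  assumes "d > 0"
    and "\<forall>i\<in>{1..t}. ds i > 0"
    and "\<forall>i\<in>{1..<t}. ds i \<le> ds (i + 1)"
    and "ds t \<le> d"
    and "ds 0 = 0"
    and "ds (t + 1) = d"
  shows "(\<forall>n. finite (labelled_partitions t d ds n) \<and>
              finite {l \<in> partitions_repeating t. n = weight t ds l} \<and>
              card (labelled_partitions t d ds n) =
              card {l \<in> partitions_repeating t. n = weight t ds l}) \<and>
         ((\<lambda>l. fps_X ^ weight t ds l) has_sum
            (1 / (\<Prod>i=1..t. qpochhammer_inf (fps_X ^ ds i) (fps_X ^ d)))) (partitions_repeating t)"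
proof -
  \<comment> \<open>The end cases \<open>i = 0\<close> and \<open>i = t\<close> come from
    \<open>ds 0 = 0\<close> and from \<open>ds t \<le> d = ds (t + 1)\<close>.\<close>
  have "ds i \<le> ds (Suc i)" if "i \<le> t" for i
  proof (cases "i = 0 \<or> i = t")
    case False
    with that have "i \<in> {1..<t}" by simp
    with assms show ?thesis by simp
  qed (use assms in auto)
  then interpret residue_weights t d ds
    using assms by unfold_locales auto
  have gf: "fiber_gf P (weight t ds) = all_gf 1"
    unfolding all_gf_def by (rule fiber_gf_P)
  have sum: "((\<lambda>l. fps_X ^ weight t ds l) has_sum
      (1 / (\<Prod>i=1..t. qpochhammer_inf (fps_X ^ ds i) (fps_X ^ d)))) P"
    unfolding all_gf_1 gf[symmetric] by (rule has_sum_fiber_gf) (rule finite_P_weight)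
  have "finite (labelled_partitions t d ds n)" for n
    using bij_betw_finite[OF labelled_partitions_bij] finite_regular_msum by blast
  moreover have "card (labelled_partitions t d ds n) = card {l \<in> P. weight t ds l = n}" for n
  proof -
    \<comment> \<open>Both cardinalities are coefficient \<open>n\<close> of the same series
      \<open>all_gf 1\<close>.\<close>
    have "of_nat (card {l \<in> P. weight t ds l = n}) = (all_gf 1 $ n :: rat)"
      unfolding gf[symmetric] by simp
    also have "\<dots> = of_nat (card (labelled_partitions t d ds n))"
      unfolding all_gf_nth bij_betw_same_card[OF labelled_partitions_bij] ..
    finally show ?thesis by (simp only: of_nat_eq_iff)
  qed
  moreover have "{l \<in> P. n = weight t ds l} = {l \<in> P. weight t ds l = n}" for n by auto
  ultimately show ?thesis
    using finite_P_weight sum by simp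
qed

end
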